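(* Let $F:\mathbb{Z}\to\mathbb{Z}$ be such that $F(x) = a x^2 + b x + c$, with $a,b,c\in\mathbb{Z}$. For $\alpha,\beta,\gamma,\delta \in \mathbb{Z}$, $$F(\alpha\gamma + b\,\beta\gamma + c\,\beta\delta) = (\alpha^2 + b\,\alpha\beta + ac\,\beta^2)(a\,\gamma^2 + b\,\gamma\delta + c\,\delta^2)$$ if and only if $$\alpha\delta - a\,\beta\gamma = 1 \quad\text{or}\quad \alpha\delta - a\,\beta\gamma = -1 - \frac{b\,(\alpha\gamma + b\,\beta\gamma + c\,\beta\delta)}{c},$$ i.e., for $A\in M_2(\mathbb{Z})$, $$F(\eta[A]) = \phi_0[A]\,\phi_1[A]$$ if and only if $\Delta[A]=1$ or $\Delta[A] = -1-\frac{b}{c}\,\eta[A]$.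
   Context: $M_2(\mathbb{Z})$ is the set of $2\times 2$ integer matrices. For $F(n)=an^2+bn+c$ and $A=\begin{pmatrix}\alpha&\beta\\ \gamma&\delta\end{pmatrix}\in M_2(\mathbb{Z})$, the integer-valued functions $\Delta,\eta,\phi_0,\phi_1$ are defined by $$\Delta[A]=\alpha\delta-a\,\beta\gamma,\quad \eta[A]=\alpha\gamma+b\,\beta\gamma+c\,\beta\delta,\quad \phi_0[A]=\alpha^2+b\,\alpha\beta+ac\,\beta^2,\quad \phi_1[A]=a\,\gamma^2+b\,\gamma\delta+c\,\delta^2.$$
   Formalization: The condition c ≠ 0 is added: the statement allows any integer c, but the second alternative divides by c and is undefined when c = 0; the quotient by c is taken in the rationals. *)

theory Defs
  imports "HOL-Analysis.Finite_Cartesian_Product"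
begin

text \<open>
  For the quadratic \<open>a n\<^sup>2 + b n + c\<close>, the functions below act on an integer matrix with rows
  \<open>(\<alpha>, \<beta>)\<close> and \<open>(\<gamma>, \<delta>)\<close>. Rows are indexed first: \<open>\<alpha> = A$1$1\<close>, \<open>\<beta> = A$1$2\<close>,
  \<open>\<gamma> = A$2$1\<close>, \<open>\<delta> = A$2$2\<close>. Each function takes as parameters the coefficients
  that occur in its formula.
\<close>

definition Delta :: "int \<Rightarrow> int^2^2 \<Rightarrow> int" where
  "Delta a A = A$1$1 * A$2$2 - a * A$1$2 * A$2$1"

definition eta :: "int \<Rightarrow> int \<Rightarrow> int^2^2 \<Rightarrow> int" where
  "eta b c A = A$1$1 * A$2$1 + b * A$1$2 * A$2$1 + c * A$1$2 * A$2$2"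

definition phi0 :: "int \<Rightarrow> int \<Rightarrow> int \<Rightarrow> int^2^2 \<Rightarrow> int" where
  "phi0 a b c A = (A$1$1)\<^sup>2 + b * A$1$1 * A$1$2 + a * c * (A$1$2)\<^sup>2"

definition phi1 :: "int \<Rightarrow> int \<Rightarrow> int \<Rightarrow> int^2^2 \<Rightarrow> int" where
  "phi1 a b c A = a * (A$2$1)\<^sup>2 + b * A$2$1 * A$2$2 + c * (A$2$2)\<^sup>2"

end

theory Submission
  imports Defs
begin

text \<open>
  Write \<open>f(x, y) = a x\<^sup>2 + b x y + c y\<^sup>2\<close>, so that \<open>F(n) = f(n, 1)\<close>. The heart of the matter is the
  composition law \<open>\<phi>\<^sub>0 \<phi>\<^sub>1 = f(\<eta>, \<Delta>)\<close> (lemma \<open>form_composition\<close>): \<open>\<phi>\<^sub>0\<close> is the principal form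
  \<open>(1, b, ac)\<close> of the discriminant of \<open>f\<close>, evaluated at \<open>(\<alpha>, \<beta>)\<close>, and \<open>\<phi>\<^sub>1 = f(\<gamma>, \<delta>)\<close>; composing
  \<open>f\<close> with the principal form gives \<open>f\<close> again. The equation \<open>F(\<eta>) = \<phi>\<^sub>0 \<phi>\<^sub>1\<close> therefore asks when
  \<open>f(\<eta>, 1) = f(\<eta>, \<Delta>)\<close>. For fixed \<open>\<eta>\<close> this is a quadratic equation in \<open>\<Delta>\<close> with the root \<open>1\<close>,
  and by Vieta the sum of its two roots is \<open>-b\<eta>/c\<close> (lemma \<open>form_eq_at_one_iff\<close>).
\<close>

text \<open>
  Let \<open>\<theta>\<^sup>2 + b \<theta> + a c = 0\<close> and let \<open>N(x - y \<theta>) = x\<^sup>2 + b x y + a c y\<^sup>2\<close> be the norm. The first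
  factor is \<open>N(\<alpha> - \<beta> \<theta>)\<close>, the norm also of the conjugate \<open>\<alpha> + b \<beta> + \<beta> \<theta>\<close>, and \<open>a\<close> times the
  second is \<open>N(a \<gamma> - \<delta> \<theta>)\<close>. Since
  \<open>(\<alpha> + b \<beta> + \<beta> \<theta>) (a \<gamma> - \<delta> \<theta>) = a \<eta> - \<Delta> \<theta>\<close>, multiplicativity of \<open>N\<close> gives the identity
  multiplied by \<open>a\<close>. As an identity of polynomials it may be divided by \<open>a\<close>, and so it holds over
  every commutative ring.
\<close>

lemma form_composition:
  fixes a b c \<alpha> \<beta> \<gamma> \<delta> :: "'a :: comm_ring_1"
  defines "\<eta> \<equiv> \<alpha> * \<gamma> + b * \<beta> * \<gamma> + c * \<beta> * \<delta>"
    and "\<Delta> \<equiv> \<alpha> * \<delta> - a * \<beta> * \<gamma>"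
  shows "(\<alpha>\<^sup>2 + b * \<alpha> * \<beta> + a * c * \<beta>\<^sup>2) * (a * \<gamma>\<^sup>2 + b * \<gamma> * \<delta> + c * \<delta>\<^sup>2)
         = a * \<eta>\<^sup>2 + b * \<eta> * \<Delta> + c * \<Delta>\<^sup>2"
  unfolding \<eta>_def \<Delta>_def by (simp add: power2_eq_square algebra_simps)

text \<open>
  The difference of the two sides is \<open>(1 - y) (b x + c (1 + y))\<close>, which vanishes exactly at
  \<open>y = 1\<close> and, when \<open>c\<close> is invertible, at \<open>y = -1 - b x / c\<close>.
\<close>

lemma form_eq_at_one_iff:
  fixes a b c x y :: "'a :: field"
  assumes "c \<noteq> 0"
  shows "a * x\<^sup>2 + b * x + c = a * x\<^sup>2 + b * x * y + c * y\<^sup>2 \<longleftrightarrow> y = 1 \<or> y = - 1 - b * x / c"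
proof -
  have "a * x\<^sup>2 + b * x + c = a * x\<^sup>2 + b * x * y + c * y\<^sup>2
        \<longleftrightarrow> (1 - y) * (b * x + c * (1 + y)) = 0"
    by (subst eq_iff_diff_eq_0) (simp add: power2_eq_square algebra_simps)
  also have "\<dots> \<longleftrightarrow> y = 1 \<or> b * x + c * (1 + y) = 0"
    by auto
  also have "b * x + c * (1 + y) = 0 \<longleftrightarrow> y = - 1 - b * x / c"
  proof -
    have "b * x + c * (1 + y) = c * (y - (- 1 - b * x / c))"
      using assms by (simp add: field_simps)
    then show ?thesis
      using assms by simp
  qed
  finally show ?thesis .
qed

theorem theorem4p3:
  fixes F :: "int \<Rightarrow> int" and a b c :: int
  assumes F: "\<And>x. F x = a * x\<^sup>2 + b * x + c"
    and c: "c \<noteq> 0"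
  shows "(\<forall>\<alpha> \<beta> \<gamma> \<delta> :: int.
            F (\<alpha> * \<gamma> + b * \<beta> * \<gamma> + c * \<beta> * \<delta>) =
              (\<alpha>\<^sup>2 + b * \<alpha> * \<beta> + a * c * \<beta>\<^sup>2) * (a * \<gamma>\<^sup>2 + b * \<gamma> * \<delta> + c * \<delta>\<^sup>2)
            \<longleftrightarrow> \<alpha> * \<delta> - a * \<beta> * \<gamma> = 1 \<or>
                rat_of_int (\<alpha> * \<delta> - a * \<beta> * \<gamma>) =
                  - 1 - rat_of_int (b * (\<alpha> * \<gamma> + b * \<beta> * \<gamma> + c * \<beta> * \<delta>)) / rat_of_int c)
       \<and> (\<forall>A :: int^2^2.
            F (eta b c A) = phi0 a b c A * phi1 a b c A
            \<longleftrightarrow> Delta a A = 1 \<or>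
                rat_of_int (Delta a A) =
                  - 1 - rat_of_int b / rat_of_int c * rat_of_int (eta b c A))"
proof -
  have entries: "F (\<alpha> * \<gamma> + b * \<beta> * \<gamma> + c * \<beta> * \<delta>) =
        (\<alpha>\<^sup>2 + b * \<alpha> * \<beta> + a * c * \<beta>\<^sup>2) * (a * \<gamma>\<^sup>2 + b * \<gamma> * \<delta> + c * \<delta>\<^sup>2)
      \<longleftrightarrow> \<alpha> * \<delta> - a * \<beta> * \<gamma> = 1 \<or>
          rat_of_int (\<alpha> * \<delta> - a * \<beta> * \<gamma>) =
            - 1 - rat_of_int (b * (\<alpha> * \<gamma> + b * \<beta> * \<gamma> + c * \<beta> * \<delta>)) / rat_of_int c"
    for \<alpha> \<beta> \<gamma> \<delta> :: int
  proof -
    define \<eta> \<Delta> where "\<eta> = \<alpha> * \<gamma> + b * \<beta> * \<gamma> + c * \<beta> * \<delta>" and "\<Delta> = \<alpha> * \<delta> - a * \<beta> * \<gamma>"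
    have "F \<eta> = a * \<eta>\<^sup>2 + b * \<eta> * \<Delta> + c * \<Delta>\<^sup>2
        \<longleftrightarrow> rat_of_int (a * \<eta>\<^sup>2 + b * \<eta> + c) = rat_of_int (a * \<eta>\<^sup>2 + b * \<eta> * \<Delta> + c * \<Delta>\<^sup>2)"
      unfolding F of_int_eq_iff ..
    also have "\<dots> \<longleftrightarrow> \<Delta> = 1 \<or> rat_of_int \<Delta> = - 1 - rat_of_int (b * \<eta>) / rat_of_int c"
      using form_eq_at_one_iff[of "rat_of_int c" "rat_of_int a" "rat_of_int \<eta>" "rat_of_int b"
          "rat_of_int \<Delta>"] c
      by simp
    finally show ?thesis
      unfolding form_composition \<eta>_def \<Delta>_def .
  qed
  have "F (eta b c A) = phi0 a b c A * phi1 a b c A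
      \<longleftrightarrow> Delta a A = 1 \<or>
          rat_of_int (Delta a A) = - 1 - rat_of_int b / rat_of_int c * rat_of_int (eta b c A)"
    for A :: "int^2^2"
    using entries[of "A$1$1" "A$2$1" "A$1$2" "A$2$2"]
    unfolding eta_def phi0_def phi1_def Delta_def of_int_mult[of b] times_divide_eq_left .
  with entries show ?thesis
    by blast
qed

end
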